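(* Let $\Gamma$ be a countably infinite group and let $\alpha:\Gamma\curvearrowright X$ be a free Borel action on a standard Borel space $X$. Then there exists an injective $\Gamma$-equivariant Borel map $\Theta'_\alpha:X\to \mathrm{Free}(\mathcal{C}^\Gamma)$ such that the closure of the set $\Theta'_\alpha(X)$ in $\mathcal{C}^\Gamma$ is still contained in $\mathrm{Free}(\mathcal{C}^\Gamma)$.
   Context: $\mathcal{C}=\{0,1\}^{\mathbb{N}}$ is the Cantor set. $\mathcal{C}^\Gamma$ is the space of all maps $\rho:\Gamma\to\mathcal{C}$ with the product topology, equipped with the Bernoulli shift, i.e. the continuous left action $L$ of $\Gamma$ given by $L_\delta(\rho)(\gamma)=\rho(\gamma\delta)$ for $\gamma,\delta\in\Gamma$. Its free part is $\mathrm{Free}(\mathcal{C}^\Gamma)=\{\rho\in\mathcal{C}^\Gamma : L_\delta(\rho)\neq\rho \text{ for all } \delta\in\Gamma,\ \delta\neq e_\Gamma\}$. A Borel action of $\Gamma$ (a discrete group) on $X$ is an action by Borel automorphisms; it is free if no non-identity element fixes any point. Equivariance means $\Theta'_\alpha(\alpha(\gamma)(x))=L_\gamma(\Theta'_\alpha(x))$ for all $\gamma\in\Gamma$, $x\in X$. *)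

theory Defs
  imports "HOL-Analysis.Analysis" "HOL-Algebra.Group_Action"
begin

definition polish_topology :: "'a topology \<Rightarrow> bool" where
  "polish_topology T \<longleftrightarrow> completely_metrizable_space T \<and> separable_space T"

definition borel_of :: "'a topology \<Rightarrow> 'a measure" where
  "borel_of T = sigma (topspace T) {U. openin T U}"

text \<open>Only \<^const>\<open>space\<close> and \<^const>\<open>sets\<close> of a \<^type>\<open>measure\<close> matter here; the
  measure it carries is ignored.\<close>

definition standard_borel :: "'a measure \<Rightarrow> bool" where
  "standard_borel M \<longleftrightarrow>
     (\<exists>T. polish_topology T \<and> space M = topspace T \<and> sets M = sets (borel_of T))"

definition borel_automorphism :: "'a measure \<Rightarrow> ('a \<Rightarrow> 'a) \<Rightarrow> bool" where
  "borel_automorphism M f \<longleftrightarrow>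
     bij_betw f (space M) (space M) \<and> f \<in> M \<rightarrow>\<^sub>M M \<and> inv_into (space M) f \<in> M \<rightarrow>\<^sub>M M"

definition borel_action ::
    "('g, 'b) monoid_scheme \<Rightarrow> 'x measure \<Rightarrow> ('g \<Rightarrow> 'x \<Rightarrow> 'x) \<Rightarrow> bool" where
  "borel_action G M \<alpha> \<longleftrightarrow>
     group_action G (space M) \<alpha> \<and> (\<forall>g \<in> carrier G. borel_automorphism M (\<alpha> g))"

definition free_action ::
    "('g, 'b) monoid_scheme \<Rightarrow> 'x set \<Rightarrow> ('g \<Rightarrow> 'x \<Rightarrow> 'x) \<Rightarrow> bool" where
  "free_action G E \<alpha> \<longleftrightarrow>
     (\<forall>g \<in> carrier G. g \<noteq> \<one>\<^bsub>G\<^esub> \<longrightarrow> (\<forall>x \<in> E. \<alpha> g x \<noteq> x))"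

definition cantor_space :: "(nat \<Rightarrow> bool) topology" where
  "cantor_space = product_topology (\<lambda>_. discrete_topology UNIV) UNIV"

text \<open>Maps from the group to the Cantor set are represented by functions that are
  \<^const>\<open>extensional\<close> on \<open>carrier G\<close>, as always for \<^const>\<open>product_topology\<close>.\<close>

definition cantor_power :: "('g, 'b) monoid_scheme \<Rightarrow> ('g \<Rightarrow> nat \<Rightarrow> bool) topology" where
  "cantor_power G = product_topology (\<lambda>_. cantor_space) (carrier G)"

definition bernoulli_shift ::
    "('g, 'b) monoid_scheme \<Rightarrow> 'g \<Rightarrow> ('g \<Rightarrow> nat \<Rightarrow> bool) \<Rightarrow> ('g \<Rightarrow> nat \<Rightarrow> bool)" where
  "bernoulli_shift G \<delta> =
     (\<lambda>\<rho> \<in> topspace (cantor_power G). \<lambda>\<gamma> \<in> carrier G. \<rho> (\<gamma> \<otimes>\<^bsub>G\<^esub> \<delta>))"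

definition free_part :: "('g, 'b) monoid_scheme \<Rightarrow> ('g \<Rightarrow> nat \<Rightarrow> bool) set" where
  "free_part G =
     {\<rho> \<in> topspace (cantor_power G).
        \<forall>\<delta> \<in> carrier G. \<delta> \<noteq> \<one>\<^bsub>G\<^esub> \<longrightarrow> bernoulli_shift G \<delta> \<rho> \<noteq> \<rho>}"

end

theory Submission
  imports Defs
begin

text \<open>An equivariant map into the shift is the same thing as a single map \<open>\<theta>\<close> from \<open>X\<close> to the
  Cantor set: put \<open>\<Theta> x \<gamma> = \<theta> (\<gamma> x)\<close>. The map \<open>\<Theta>\<close> is injective as soon as \<open>\<theta>\<close> is, and \<open>\<theta>\<close> is
  injective if its bits record membership in each set of a countable family separating points.

  The remaining bits of \<open>\<theta>\<close> make freeness survive the passage to the closure. Freeness of \<open>\<rho>\<close>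
  follows if \<open>\<rho> \<gamma> \<noteq> \<rho> \<one>\<close> for each \<open>\<gamma> \<noteq> \<one>\<close>, but each of these conditions is only open. It becomes
  closed if the difference is always visible in a finite set of bits that depends on \<open>\<gamma>\<close>
  alone (\<open>closedin_differ_at_finitely_many_bits\<close>). So for each \<open>\<gamma> \<noteq> \<one>\<close> the map \<open>\<theta>\<close> records,
  in finitely many bits, a Borel colouring \<open>d\<close> of \<open>X\<close> with finitely many colours and
  \<open>d (\<gamma> x) \<noteq> d x\<close> everywhere. Such a colouring with three colours exists because the graph that
  joins \<open>x\<close> to \<open>\<gamma> x\<close> has degree at most two: the separating family gives a Borel colouring with
  countably many colours, and one recolours its classes greedily, one after the other
  (\<open>fixpoint_free_three_colouring\<close>). Only countably many bits are used, as the group is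
  countable.\<close>

section \<open>Borel colourings of fixed-point free maps\<close>

text \<open>The separation is asymmetric, as for a base of a \<open>T\<^sub>1\<close> topology: the set contains the first
  point. This makes \<open>B n - f -` B n\<close>, a set disjoint from its preimage under \<open>f\<close>, contain \<open>x\<close> for
  some \<open>n\<close> whenever \<open>f x \<noteq> x\<close>.\<close>

lemma standard_borel_separating_sequence:
  assumes "standard_borel M"
  obtains B :: "nat \<Rightarrow> 'x set" where "\<And>n. B n \<in> sets M"
    and "\<And>x y. x \<in> space M \<Longrightarrow> y \<in> space M \<Longrightarrow> x \<noteq> y \<Longrightarrow> \<exists>n. x \<in> B n \<and> y \<notin> B n"
proof -
  obtain T where T: "completely_metrizable_space T" "separable_space T"
      "space M = topspace T" "sets M = sets (borel_of T)"
    using assms by (auto simp: standard_borel_def polish_topology_def)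
  then obtain S d where Sd: "Metric_space S d" "T = Metric_space.mtopology S d"
    unfolding completely_metrizable_space_def by blast
  interpret Metric_space S d by fact
  obtain C where C: "countable C" "C \<subseteq> S" "T closure_of C = S"
    using T(2) Sd(2) by (auto simp: separable_space_def)
  define B where "B = (\<lambda>n. case prod_decode n of (i, k) \<Rightarrow>
    if C = {} then {} else mball (from_nat_into C i) (1 / Suc k))"
  show thesis
  proof (rule that)
    fix n
    have "openin T (B n)"
      by (auto simp: B_def Sd(2) split: prod.split)
    then show "B n \<in> sets M"
      unfolding T(4) borel_of_def by (auto dest: openin_subset)
  next
    fix x y assume xy: "x \<in> space M" "y \<in> space M" "x \<noteq> y"
    then have S: "x \<in> S" "y \<in> S" using T(3) Sd(2) by auto
    then have "0 < d x y" using xy by simp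
    then obtain k where k: "1 / Suc k < d x y / 2"
      using nat_approx_posE[of "d x y / 2"] by auto
    have "x \<in> mtopology closure_of C" using C(3) S Sd(2) by simp
    then have "\<exists>c\<in>C. c \<in> mball x (1 / Suc k)"
      by (simp only: metric_closure_of mem_Collect_eq) simp
    then obtain c where c: "c \<in> C" "c \<in> mball x (1 / Suc k)" by blast
    obtain i where i: "from_nat_into C i = c"
      using from_nat_into_surj[OF C(1) c(1)] by blast
    have "d x y \<le> d c x + d c y"
      using triangle[of x c y] S C(2) c commute by auto
    then have "x \<in> mball c (1 / Suc k)" "y \<notin> mball c (1 / Suc k)"
      using c k S C(2) by (auto simp: commute)
    then have "x \<in> B (prod_encode (i, k)) \<and> y \<notin> B (prod_encode (i, k))"
      using i c(1) by (auto simp: B_def)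
    then show "\<exists>n. x \<in> B n \<and> y \<notin> B n" by blast
  qed
qed

definition least_free_colour :: "nat \<Rightarrow> nat \<Rightarrow> nat" where
  "least_free_colour a b = (if 0 \<notin> {a, b} then 0 else if 1 \<notin> {a, b} then 1 else 2)"

text \<open>Stage \<open>n\<close> of the greedy recolouring of a colouring \<open>c\<close> by natural numbers has treated the
  points with \<open>c\<close>-colour below \<open>n\<close>; all others carry the value 3, for ``uncoloured''. The
  neighbours of a point are its images under \<open>f\<close> and \<open>g\<close>.\<close>

primrec greedy_stage :: "('x \<Rightarrow> nat) \<Rightarrow> ('x \<Rightarrow> 'x) \<Rightarrow> ('x \<Rightarrow> 'x) \<Rightarrow> nat \<Rightarrow> 'x \<Rightarrow> nat" where
  "greedy_stage c f g 0 x = 3"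
| "greedy_stage c f g (Suc n) x =
     (if c x = n then least_free_colour (greedy_stage c f g n (f x)) (greedy_stage c f g n (g x))
      else greedy_stage c f g n x)"

lemma greedy_stage_stable:
  "c x < n \<Longrightarrow> greedy_stage c f g n x = greedy_stage c f g (Suc (c x)) x"
  by (induction n) (auto simp: less_Suc_eq)

lemma measurable_greedy_stage:
  assumes [measurable]: "c \<in> M \<rightarrow>\<^sub>M count_space UNIV" "f \<in> M \<rightarrow>\<^sub>M M" "g \<in> M \<rightarrow>\<^sub>M M"
  shows "greedy_stage c f g n \<in> M \<rightarrow>\<^sub>M count_space UNIV"
proof (induction n)
  case (Suc n)
  note Suc[measurable]
  have "(\<lambda>x. greedy_stage c f g (Suc n) x) \<in> M \<rightarrow>\<^sub>M count_space UNIV"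
    unfolding greedy_stage.simps by measurable
  then show ?case by simp
next
  case 0
  have "(\<lambda>x. greedy_stage c f g 0 x) \<in> M \<rightarrow>\<^sub>M count_space UNIV"
    unfolding greedy_stage.simps by measurable
  then show ?case by simp
qed

text \<open>Of two adjacent points, the one with the larger old colour is recoloured later, and then
  avoids the new colour of the other. A left inverse \<open>g\<close> of \<open>f\<close> is enough to make adjacency
  symmetric on the edges from \<open>x\<close> to \<open>f x\<close>.\<close>

lemma three_colouring_from_countable_colouring:
  assumes c: "c \<in> M \<rightarrow>\<^sub>M count_space (UNIV :: nat set)"
    and f: "f \<in> M \<rightarrow>\<^sub>M M" and g: "g \<in> M \<rightarrow>\<^sub>M M"
    and inv: "\<And>x. x \<in> space M \<Longrightarrow> g (f x) = x"
    and neq: "\<And>x. x \<in> space M \<Longrightarrow> c (f x) \<noteq> c x"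
  obtains d :: "'x \<Rightarrow> nat" where "d \<in> M \<rightarrow>\<^sub>M count_space UNIV"
    and "\<And>x. d x < 3" and "\<And>x. x \<in> space M \<Longrightarrow> d (f x) \<noteq> d x"
proof (rule that)
  let ?d = "\<lambda>x. greedy_stage c f g (Suc (c x)) x"
  show "?d \<in> M \<rightarrow>\<^sub>M count_space UNIV"
    by (rule measurable_compose_countable[OF measurable_greedy_stage[OF c f g]])
      (rule measurable_compose[OF c], simp)
  show "?d x < 3" for x
    by (auto simp: least_free_colour_def)
  show "?d (f x) \<noteq> ?d x" if x: "x \<in> space M" for x
  proof (cases "c x < c (f x)")
    case True
    then have "?d (f x) = least_free_colour (greedy_stage c f g (c (f x)) (f (f x))) (?d x)"
      using inv[OF x] greedy_stage_stable[of c x, OF True] by simp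
    then show ?thesis
      by (auto simp: least_free_colour_def simp del: greedy_stage.simps)
  next
    case False
    then have less: "c (f x) < c x" using neq[OF x] by simp
    then have "?d x = least_free_colour (?d (f x)) (greedy_stage c f g (c x) (g x))"
      using greedy_stage_stable[of c "f x", OF less] by simp
    then show ?thesis
      by (auto simp: least_free_colour_def simp del: greedy_stage.simps)
  qed
qed

lemma fixpoint_free_three_colouring:
  assumes B: "\<And>n::nat. B n \<in> sets M"
    and sep: "\<And>x y. x \<in> space M \<Longrightarrow> y \<in> space M \<Longrightarrow> x \<noteq> y \<Longrightarrow> \<exists>n. x \<in> B n \<and> y \<notin> B n"
    and f: "f \<in> M \<rightarrow>\<^sub>M M" and g: "g \<in> M \<rightarrow>\<^sub>M M"
    and inv: "\<And>x. x \<in> space M \<Longrightarrow> g (f x) = x"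
    and free: "\<And>x. x \<in> space M \<Longrightarrow> f x \<noteq> x"
  obtains d :: "'x \<Rightarrow> nat" where "d \<in> M \<rightarrow>\<^sub>M count_space UNIV"
    and "\<And>x. d x < 3" and "\<And>x. x \<in> space M \<Longrightarrow> d (f x) \<noteq> d x"
proof -
  note [measurable] = B f g
  define c where "c = (\<lambda>x. LEAST n. x \<in> B n \<and> f x \<notin> B n)"
  have c_in: "x \<in> B (c x) \<and> f x \<notin> B (c x)" if "x \<in> space M" for x
    unfolding c_def
    by (rule LeastI_ex) (use sep[OF that measurable_space[OF f that]] free[OF that] in metis)
  have "c \<in> M \<rightarrow>\<^sub>M count_space UNIV"
    unfolding c_def by measurable
  moreover have "c (f x) \<noteq> c x" if "x \<in> space M" for x
    using c_in[OF that] c_in[OF measurable_space[OF f that]] by metis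
  ultimately show thesis
    using three_colouring_from_countable_colouring[OF _ f g inv] that by blast
qed

section \<open>The space of maps from a group to the Cantor set\<close>

lemma topspace_cantor_power: "topspace (cantor_power G) = extensional (carrier G)"
  by (auto simp: cantor_power_def cantor_space_def PiE_def)

lemma closedin_bit:
  assumes "\<gamma> \<in> carrier G"
  shows "closedin (cantor_power G) {\<rho> \<in> topspace (cantor_power G). P (\<rho> \<gamma> n)}"
proof -
  have "continuous_map (cantor_power G) cantor_space (\<lambda>\<rho>. \<rho> \<gamma>)"
    unfolding cantor_power_def by (rule continuous_map_product_projection[OF assms])
  moreover have "continuous_map cantor_space (discrete_topology UNIV) (\<lambda>a. a n)"
    unfolding cantor_space_def by (rule continuous_map_product_projection) simp
  ultimately have cont: "continuous_map (cantor_power G) (discrete_topology UNIV) (\<lambda>\<rho>. \<rho> \<gamma> n)"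
    using continuous_map_compose[of _ _ "\<lambda>\<rho>. \<rho> \<gamma>" _ "\<lambda>a. a n"] by (simp add: o_def)
  show "closedin (cantor_power G) {\<rho> \<in> topspace (cantor_power G). P (\<rho> \<gamma> n)}"
    using closedin_continuous_map_preimage[OF cont, of "Collect P"] by simp
qed

text \<open>Finiteness of \<open>N\<close> is the point: \<open>\<rho> \<gamma> \<noteq> \<rho> \<delta>\<close> by itself defines an open set, which is not
  closed in general.\<close>

lemma closedin_differ_at_finitely_many_bits:
  assumes "\<gamma> \<in> carrier G" "\<delta> \<in> carrier G" "finite N"
  shows "closedin (cantor_power G) {\<rho> \<in> topspace (cantor_power G). \<exists>n\<in>N. \<rho> \<gamma> n \<noteq> \<rho> \<delta> n}"
proof -
  let ?S = "\<lambda>\<gamma> n b. {\<rho> \<in> topspace (cantor_power G). \<rho> \<gamma> n = b}"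
  have "{\<rho> \<in> topspace (cantor_power G). \<exists>n\<in>N. \<rho> \<gamma> n \<noteq> \<rho> \<delta> n} =
      (\<Union>n\<in>N. (?S \<gamma> n True \<inter> ?S \<delta> n False) \<union> (?S \<gamma> n False \<inter> ?S \<delta> n True))"
    by auto
  moreover have "closedin (cantor_power G) \<dots>"
    using assms by (intro closedin_Union) (auto intro!: closedin_Un closedin_Int closedin_bit)
  ultimately show ?thesis by simp
qed

lemma openin_cantor_space_cylinder:
  assumes "openin cantor_space V" "a \<in> V"
  obtains N where "finite N" "\<And>b. (\<And>n. n \<in> N \<Longrightarrow> b n = a n) \<Longrightarrow> b \<in> V"
proof -
  obtain U where U: "finite {i. U i \<noteq> UNIV}" "a \<in> Pi\<^sub>E UNIV U" "Pi\<^sub>E UNIV U \<subseteq> V"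
    using assms unfolding cantor_space_def openin_product_topology_alt by fastforce
  have "b \<in> V" if "\<And>n. n \<in> {i. U i \<noteq> UNIV} \<Longrightarrow> b n = a n" for b
  proof -
    have "b n \<in> U n" for n
      using that[of n] U(2) by (cases "U n = UNIV") auto
    then show ?thesis using U(3) by auto
  qed
  then show thesis using U(1) that by blast
qed

lemma openin_cantor_power_cylinder:
  assumes "openin (cantor_power G) U" "\<rho> \<in> U"
  obtains K where "finite K" "K \<subseteq> carrier G \<times> UNIV"
    and "\<And>\<sigma>. \<sigma> \<in> topspace (cantor_power G) \<Longrightarrow> (\<And>\<gamma> n. (\<gamma>, n) \<in> K \<Longrightarrow> \<sigma> \<gamma> n = \<rho> \<gamma> n) \<Longrightarrow> \<sigma> \<in> U"
proof -
  have top: "topspace cantor_space = UNIV" by (simp add: cantor_space_def)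
  obtain V where V: "finite {\<gamma> \<in> carrier G. V \<gamma> \<noteq> UNIV}"
      "\<And>\<gamma>. \<gamma> \<in> carrier G \<Longrightarrow> openin cantor_space (V \<gamma>)"
      "\<rho> \<in> Pi\<^sub>E (carrier G) V" "Pi\<^sub>E (carrier G) V \<subseteq> U"
    using assms unfolding cantor_power_def openin_product_topology_alt top by fastforce
  have "\<exists>N. finite N \<and> (\<forall>b. (\<forall>n\<in>N. b n = \<rho> \<gamma> n) \<longrightarrow> b \<in> V \<gamma>)" if "\<gamma> \<in> carrier G" for \<gamma>
    using openin_cantor_space_cylinder[OF V(2)[OF that]] V(3) that by (metis PiE_mem)
  then obtain N where N: "\<And>\<gamma>. \<gamma> \<in> carrier G \<Longrightarrow> finite (N \<gamma>)"
      "\<And>\<gamma> b. \<gamma> \<in> carrier G \<Longrightarrow> (\<forall>n\<in>N \<gamma>. b n = \<rho> \<gamma> n) \<Longrightarrow> b \<in> V \<gamma>"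
    by metis
  show thesis
  proof (rule that)
    let ?K = "Sigma {\<gamma> \<in> carrier G. V \<gamma> \<noteq> UNIV} N"
    show "finite ?K" "?K \<subseteq> carrier G \<times> UNIV" using V(1) N(1) by auto
    fix \<sigma> assume \<sigma>: "\<sigma> \<in> topspace (cantor_power G)"
      and eq: "\<And>\<gamma> n. (\<gamma>, n) \<in> ?K \<Longrightarrow> \<sigma> \<gamma> n = \<rho> \<gamma> n"
    have "\<sigma> \<gamma> \<in> V \<gamma>" if "\<gamma> \<in> carrier G" for \<gamma>
      using N(2)[OF that, of "\<sigma> \<gamma>"] eq[of \<gamma>] that by (cases "V \<gamma> = UNIV") auto
    then show "\<sigma> \<in> U" using V(4) \<sigma> by (auto simp: topspace_cantor_power PiE_def)
  qed
qed

text \<open>For a countable group there are only countably many cylinders, so an open set is a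
  countable union of cylinders and measurability can be tested bit by bit.\<close>

lemma measurable_borel_of_cantor_power:
  assumes G: "countable (carrier G)"
    and f: "\<And>x. x \<in> space M \<Longrightarrow> f x \<in> topspace (cantor_power G) \<inter> S"
    and bit: "\<And>\<gamma> n. \<gamma> \<in> carrier G \<Longrightarrow> {x \<in> space M. f x \<gamma> n} \<in> sets M"
  shows "f \<in> M \<rightarrow>\<^sub>M borel_of (subtopology (cantor_power G) S)"
  unfolding borel_of_def
proof (rule measurable_measure_of)
  show "{U. openin (subtopology (cantor_power G) S) U}
      \<subseteq> Pow (topspace (subtopology (cantor_power G) S))"
    by (blast dest: openin_subset)
  show "f \<in> space M \<rightarrow> topspace (subtopology (cantor_power G) S)"
    using f by auto
  fix W assume "W \<in> {U. openin (subtopology (cantor_power G) S) U}"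
  then obtain U where U: "openin (cantor_power G) U" "W = U \<inter> S"
    by (auto simp: openin_subtopology)
  define cyl where "cyl = (\<lambda>(A, B). {\<rho> \<in> topspace (cantor_power G).
    (\<forall>i\<in>A. \<rho> (fst i) (snd i)) \<and> (\<forall>i\<in>B. \<not> \<rho> (fst i) (snd i))})"
  define F where "F = {A. A \<subseteq> carrier G \<times> (UNIV :: nat set) \<and> finite A}"
  define I where "I = {AB \<in> F \<times> F. cyl AB \<subseteq> U}"
  have "countable F"
    unfolding F_def using countable_Collect_finite_subset[OF countable_SIGMA[OF G, of "\<lambda>_. UNIV :: nat set"]]
    by (simp add: conj_commute)
  then have "countable (F \<times> F)" by simp
  then have I: "countable I"
    unfolding I_def by (rule countable_subset[rotated]) auto
  have "\<rho> \<in> (\<Union>AB\<in>I. cyl AB)" if \<rho>: "\<rho> \<in> U" for \<rho>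
  proof -
    obtain K where K: "finite K" "K \<subseteq> carrier G \<times> UNIV"
        "\<And>\<sigma>. \<sigma> \<in> topspace (cantor_power G) \<Longrightarrow> (\<And>\<gamma> n. (\<gamma>, n) \<in> K \<Longrightarrow> \<sigma> \<gamma> n = \<rho> \<gamma> n) \<Longrightarrow> \<sigma> \<in> U"
      using openin_cantor_power_cylinder[OF U(1) \<rho>] by blast
    let ?AB = "({i \<in> K. \<rho> (fst i) (snd i)}, {i \<in> K. \<not> \<rho> (fst i) (snd i)})"
    have "cyl ?AB \<subseteq> U"
    proof
      fix \<sigma> assume "\<sigma> \<in> cyl ?AB"
      then have "\<sigma> \<in> topspace (cantor_power G)" "\<And>\<gamma> n. (\<gamma>, n) \<in> K \<Longrightarrow> \<sigma> \<gamma> n = \<rho> \<gamma> n"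
        by (auto simp: cyl_def)
      then show "\<sigma> \<in> U" by (rule K(3))
    qed
    then have "?AB \<in> I" using K(1,2) by (auto simp: I_def F_def)
    moreover have "\<rho> \<in> cyl ?AB"
      using \<rho> openin_subset[OF U(1)] by (auto simp: cyl_def)
    ultimately show ?thesis by blast
  qed
  then have "U = (\<Union>AB\<in>I. cyl AB)" by (auto simp: I_def)
  then have "f -` W \<inter> space M = (\<Union>AB\<in>I. {x \<in> space M. f x \<in> cyl AB})"
    using U(2) f by auto
  moreover have "{x \<in> space M. f x \<in> cyl AB} \<in> sets M" if "AB \<in> I" for AB
  proof -
    obtain A B where AB: "AB = (A, B)" by (cases AB)
    then have fin: "finite A" "finite B" "A \<subseteq> carrier G \<times> UNIV" "B \<subseteq> carrier G \<times> UNIV"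
      using that by (auto simp: I_def F_def)
    have "{x \<in> space M. f x \<in> cyl AB} = {x \<in> space M.
        (\<forall>i\<in>A. f x (fst i) (snd i)) \<and> (\<forall>i\<in>B. \<not> f x (fst i) (snd i))}"
      using f by (auto simp: AB cyl_def)
    also have "\<dots> \<in> sets M"
      using fin
      by (intro sets.sets_Collect_conj sets.sets_Collect_finite_All sets.sets_Collect_neg bit) auto
    finally show ?thesis .
  qed
  ultimately show "f -` W \<inter> space M \<in> sets M"
    using I by auto
qed

section \<open>The equivariant map\<close>

lemma in_free_partI:
  assumes "group G" "\<rho> \<in> topspace (cantor_power G)"
    and "\<And>\<gamma>. \<gamma> \<in> carrier G \<Longrightarrow> \<gamma> \<noteq> \<one>\<^bsub>G\<^esub> \<Longrightarrow> \<rho> \<gamma> \<noteq> \<rho> \<one>\<^bsub>G\<^esub>"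
  shows "\<rho> \<in> free_part G"
proof -
  interpret group G by fact
  have "bernoulli_shift G \<delta> \<rho> \<one>\<^bsub>G\<^esub> = \<rho> \<delta>" if "\<delta> \<in> carrier G" for \<delta>
    using assms(2) that by (simp add: bernoulli_shift_def)
  then show ?thesis
    using assms(2,3) by (fastforce simp: free_part_def)
qed

theorem proposition1p1:
  fixes G :: "('g, 'b) monoid_scheme"
    and M :: "'x measure"
    and \<alpha> :: "'g \<Rightarrow> 'x \<Rightarrow> 'x"
  assumes "group G"
    and "countable (carrier G)"
    and "infinite (carrier G)"
    and "standard_borel M"
    and "borel_action G M \<alpha>"
    and "free_action G (space M) \<alpha>"
  shows "\<exists>\<Theta> :: 'x \<Rightarrow> 'g \<Rightarrow> nat \<Rightarrow> bool.
           \<Theta> \<in> M \<rightarrow>\<^sub>M borel_of (subtopology (cantor_power G) (free_part G)) \<and>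
           inj_on \<Theta> (space M) \<and>
           (\<forall>\<gamma> \<in> carrier G. \<forall>x \<in> space M. \<Theta> (\<alpha> \<gamma> x) = bernoulli_shift G \<gamma> (\<Theta> x)) \<and>
           cantor_power G closure_of (\<Theta> ` space M) \<subseteq> free_part G"
proof -
  interpret group G by fact
  interpret act: group_action G "space M" \<alpha>
    using assms(5) by (simp add: borel_action_def)
  have meas: "\<alpha> \<gamma> \<in> M \<rightarrow>\<^sub>M M" if "\<gamma> \<in> carrier G" for \<gamma>
    using assms(5) that by (auto simp: borel_action_def borel_automorphism_def)
  have comp: "\<alpha> (\<gamma> \<otimes>\<^bsub>G\<^esub> \<delta>) x = \<alpha> \<gamma> (\<alpha> \<delta> x)"
    if "\<gamma> \<in> carrier G" "\<delta> \<in> carrier G" "x \<in> space M" for \<gamma> \<delta> x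
    using act.composition_rule[OF that(3,1,2)] .
  have one: "\<alpha> \<one>\<^bsub>G\<^esub> x = x" if "x \<in> space M" for x
    using fun_cong[OF act.id_eq_one, of x] that by simp
  obtain B :: "nat \<Rightarrow> 'x set" where B: "\<And>n. B n \<in> sets M"
    and sep: "\<And>x y. x \<in> space M \<Longrightarrow> y \<in> space M \<Longrightarrow> x \<noteq> y \<Longrightarrow> \<exists>n. x \<in> B n \<and> y \<notin> B n"
    using standard_borel_separating_sequence[OF assms(4)] by blast
  have "\<exists>d :: 'x \<Rightarrow> nat. d \<in> M \<rightarrow>\<^sub>M count_space UNIV \<and> (\<forall>x. d x < 3) \<and>
      (\<gamma> \<noteq> \<one>\<^bsub>G\<^esub> \<longrightarrow> (\<forall>x\<in>space M. d (\<alpha> \<gamma> x) \<noteq> d x))" if \<gamma>: "\<gamma> \<in> carrier G" for \<gamma>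
  proof (cases "\<gamma> = \<one>\<^bsub>G\<^esub>")
    case True
    then show ?thesis by (intro exI[of _ "\<lambda>_. 0"]) auto
  next
    case False
    have "\<alpha> (inv\<^bsub>G\<^esub> \<gamma>) (\<alpha> \<gamma> x) = x" if "x \<in> space M" for x
      using comp[of "inv\<^bsub>G\<^esub> \<gamma>" \<gamma> x] one that \<gamma> by simp
    moreover have "\<alpha> \<gamma> x \<noteq> x" if "x \<in> space M" for x
      using assms(6) False \<gamma> that by (auto simp: free_action_def)
    ultimately obtain d :: "'x \<Rightarrow> nat" where "d \<in> M \<rightarrow>\<^sub>M count_space UNIV"
      "\<And>x. d x < 3" "\<And>x. x \<in> space M \<Longrightarrow> d (\<alpha> \<gamma> x) \<noteq> d x"
      using fixpoint_free_three_colouring[OF B sep meas[OF \<gamma>] meas[of "inv\<^bsub>G\<^esub> \<gamma>"]] \<gamma> by auto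
    then show ?thesis by blast
  qed
  then obtain d :: "'g \<Rightarrow> 'x \<Rightarrow> nat"
    where d_meas: "\<And>\<gamma>. \<gamma> \<in> carrier G \<Longrightarrow> d \<gamma> \<in> M \<rightarrow>\<^sub>M count_space UNIV"
      and d_less: "\<And>\<gamma> x. \<gamma> \<in> carrier G \<Longrightarrow> d \<gamma> x < 3"
      and d_neq: "\<And>\<gamma> x. \<gamma> \<in> carrier G \<Longrightarrow> \<gamma> \<noteq> \<one>\<^bsub>G\<^esub> \<Longrightarrow> x \<in> space M \<Longrightarrow> d \<gamma> (\<alpha> \<gamma> x) \<noteq> d \<gamma> x"
    by metis
  define enum where "enum = from_nat_into (carrier G)"
  have enum_in: "enum j \<in> carrier G" for j
    unfolding enum_def by (rule from_nat_into) auto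

  \<comment> \<open>Row 0 of the doubly indexed bits identifies the point. Row \<open>Suc j\<close> has its
    single true bit at the colour of the point for the \<open>j\<close>th group element, hence varies only in
    the columns 0, 1 and 2.\<close>
  define \<theta> where "\<theta> = (\<lambda>x n. case prod_decode n of
    (0, k) \<Rightarrow> x \<in> B k | (Suc j, k) \<Rightarrow> d (enum j) x = k)"
  have \<theta>_meas: "{x \<in> space M. \<theta> x n} \<in> sets M" for n
  proof -
    obtain i k where n: "prod_decode n = (i, k)" by (cases "prod_decode n")
    show ?thesis
    proof (cases i)
      case 0
      then show ?thesis
        using sets.Int[OF sets.top B[of k]] by (simp add: \<theta>_def n Int_def)
    next
      case (Suc j)
      note [measurable] = d_meas[OF enum_in]
      have "{x \<in> space M. d (enum j) x = k} \<in> sets M" by measurable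
      then show ?thesis by (simp add: \<theta>_def n Suc)
    qed
  qed
  have \<theta>_inj: "x = y" if "\<theta> x = \<theta> y" "x \<in> space M" "y \<in> space M" for x y
  proof (rule ccontr)
    assume "x \<noteq> y"
    from sep[OF that(2,3) this] obtain k where "x \<in> B k" "y \<notin> B k" by blast
    then show False
      using fun_cong[OF that(1), of "prod_encode (0, k)"] by (simp add: \<theta>_def)
  qed
  have \<theta>_neq: "\<exists>n \<in> (\<lambda>k. prod_encode (Suc j, k)) ` {..<3}. \<theta> (\<alpha> (enum j) x) n \<noteq> \<theta> x n"
    if "enum j \<noteq> \<one>\<^bsub>G\<^esub>" "x \<in> space M" for j x
    using d_neq[OF enum_in that] d_less[OF enum_in, of j x]
    by (intro bexI[of _ "prod_encode (Suc j, d (enum j) x)"]) (auto simp: \<theta>_def)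

  define \<Theta> where "\<Theta> = (\<lambda>x. \<lambda>\<gamma>\<in>carrier G. \<theta> (\<alpha> \<gamma> x))"
  have \<Theta>_top: "\<Theta> x \<in> topspace (cantor_power G)" for x
    by (simp add: \<Theta>_def topspace_cantor_power)
  have closure_free: "cantor_power G closure_of (\<Theta> ` space M) \<subseteq> free_part G"
  proof
    fix \<rho> assume \<rho>: "\<rho> \<in> cantor_power G closure_of (\<Theta> ` space M)"
    show "\<rho> \<in> free_part G"
    proof (rule in_free_partI[OF assms(1)])
      show "\<rho> \<in> topspace (cantor_power G)"
        using \<rho> by (simp add: in_closure_of)
      fix \<gamma> assume \<gamma>: "\<gamma> \<in> carrier G" "\<gamma> \<noteq> \<one>\<^bsub>G\<^esub>"
      obtain j where j: "enum j = \<gamma>"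
        unfolding enum_def using from_nat_into_surj[OF assms(2) \<gamma>(1)] by blast
      let ?N = "(\<lambda>k. prod_encode (Suc j, k)) ` {..<3}"
      let ?K = "{\<rho> \<in> topspace (cantor_power G). \<exists>n\<in>?N. \<rho> \<gamma> n \<noteq> \<rho> \<one>\<^bsub>G\<^esub> n}"
      have "\<Theta> ` space M \<subseteq> ?K"
        using \<Theta>_top \<theta>_neq[of j] \<gamma> by (auto simp: j \<Theta>_def one)
      moreover have "closedin (cantor_power G) ?K"
        using \<gamma>(1) by (intro closedin_differ_at_finitely_many_bits) auto
      ultimately have "\<rho> \<in> ?K"
        using \<rho> closure_of_minimal by blast
      then show "\<rho> \<gamma> \<noteq> \<rho> \<one>\<^bsub>G\<^esub>" by auto
    qed
  qed
  have \<Theta>_free: "\<Theta> x \<in> free_part G" if "x \<in> space M" for x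
    using closure_free closure_of_subset[of "\<Theta> ` space M" "cantor_power G"] \<Theta>_top that by blast
  have "\<Theta> \<in> M \<rightarrow>\<^sub>M borel_of (subtopology (cantor_power G) (free_part G))"
  proof (rule measurable_borel_of_cantor_power[OF assms(2)])
    show "\<Theta> x \<in> topspace (cantor_power G) \<inter> free_part G" if "x \<in> space M" for x
      using \<Theta>_top \<Theta>_free that by simp
    show "{x \<in> space M. \<Theta> x \<gamma> n} \<in> sets M" if \<gamma>: "\<gamma> \<in> carrier G" for \<gamma> n
    proof -
      have "{x \<in> space M. \<Theta> x \<gamma> n} = \<alpha> \<gamma> -` {x \<in> space M. \<theta> x n} \<inter> space M"
        using \<gamma> measurable_space[OF meas[OF \<gamma>]] by (auto simp: \<Theta>_def)
      then show ?thesis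
        using measurable_sets[OF meas[OF \<gamma>] \<theta>_meas] by simp
    qed
  qed
  moreover have "inj_on \<Theta> (space M)"
  proof (rule inj_onI)
    fix x y assume xy: "x \<in> space M" "y \<in> space M" "\<Theta> x = \<Theta> y"
    have "\<Theta> z \<one>\<^bsub>G\<^esub> = \<theta> z" if "z \<in> space M" for z
      using that by (simp add: \<Theta>_def one)
    then have "\<theta> x = \<theta> y" using xy by metis
    then show "x = y" using \<theta>_inj xy by blast
  qed
  moreover have "\<Theta> (\<alpha> \<gamma> x) = bernoulli_shift G \<gamma> (\<Theta> x)"
    if "\<gamma> \<in> carrier G" "x \<in> space M" for \<gamma> x
    using \<Theta>_top[of x] that by (auto simp: bernoulli_shift_def \<Theta>_def comp intro!: restrict_ext)
  ultimately show ?thesis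
    using closure_free by blast
qed

end
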